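(* Let $k\to\infty$, let $c=c(k)>0$ satisfy $c=o(k)$ (so $c$ need not be constant), and let $p=\frac{c}{k}$. For every sequence of finite graphs $G=G(k)$ with minimum degree at least $k$, the random subgraph $G_p$ asymptotically almost surely contains a path of length at least $(1-2c^{-1/2})k$.
   Context: For a graph $G$ and $p\in[0,1]$, $G_p$ denotes the random subgraph of $G$ on the same vertex set obtained by keeping each edge of $G$ independently with probability $p$. All quantities ($G$, $p$, $c$) are sequences indexed by $k$, and "asymptotically almost surely" (a.a.s.) means with probability tending to $1$ as $k\to\infty$. The length of a path is its number of edges. *)

theory Defs
  imports "HOL-Probability.Probability" "HOL-Library.Landau_Symbols"
begin

record 'a ugraph =
  vertices :: "'a set"
  edges :: "'a set set"

text \<open>Finite simple graphs; edges are two-element sets of vertices. As usual, the null graph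
  (without vertices) does not count as a graph, so that the minimum degree is well defined.\<close>

definition finite_graph :: "'a ugraph \<Rightarrow> bool" where
  "finite_graph G \<longleftrightarrow> finite (vertices G) \<and> vertices G \<noteq> {} \<and>
     (\<forall>e \<in> edges G. e \<subseteq> vertices G \<and> card e = 2)"

definition degree :: "'a ugraph \<Rightarrow> 'a \<Rightarrow> nat" where
  "degree G v = card {e \<in> edges G. v \<in> e}"

definition min_degree :: "'a ugraph \<Rightarrow> nat" where
  "min_degree G = Min (degree G ` vertices G)"

definition is_path :: "'a ugraph \<Rightarrow> 'a list \<Rightarrow> bool" where
  "is_path G vs \<longleftrightarrow> vs \<noteq> [] \<and> distinct vs \<and> set vs \<subseteq> vertices G \<and>
     (\<forall>i. Suc i < length vs \<longrightarrow> {vs ! i, vs ! Suc i} \<in> edges G)"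

text \<open>Paths are represented by their vertex sequence; the length counts edges.\<close>

definition path_length :: "'a list \<Rightarrow> nat" where
  "path_length vs = length vs - 1"

text \<open>The distribution of \<open>G\<^sub>p\<close>, for finite \<open>G\<close>. The function \<open>bernoulli_pmf\<close> truncates its
  argument to the interval from 0 to 1.\<close>

definition random_subgraph :: "'a ugraph \<Rightarrow> real \<Rightarrow> 'a ugraph pmf" where
  "random_subgraph G p =
     map_pmf (\<lambda>keep. \<lparr>vertices = vertices G, edges = {e \<in> edges G. keep e}\<rparr>)
       (Pi_pmf (edges G) False (\<lambda>_. bernoulli_pmf p))"

definition asymptotically_almost_surely :: "(nat \<Rightarrow> 'b pmf) \<Rightarrow> (nat \<Rightarrow> 'b \<Rightarrow> bool) \<Rightarrow> bool" where
  "asymptotically_almost_surely M P \<longleftrightarrow>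
     (\<lambda>k. measure_pmf.prob (M k) {x. P k x}) \<longlonglongrightarrow> 1"

end

theory Submission
  imports Defs
begin

text \<open>Explore the random subgraph by depth-first search, revealing an edge of \<open>G\<close> only when the
  search asks for it. Let \<open>S\<close> be the set of finished vertices, \<open>U\<close> the stack, which is a path, and
  \<open>T\<close> the set of untouched vertices. Every edge between \<open>S\<close> and \<open>T\<close> has been queried with a
  negative answer. Put \<open>x = k / sqrt c\<close>. If the stack never has more than about \<open>k - 2x\<close>
  vertices, then at the moment where \<open>card S\<close> is about \<open>x\<close> there are at least about
  \<open>x (k - (k - 2x) - x) = k\<^sup>2 / c\<close> edges between \<open>S\<close> and \<open>T\<close>. Among so many queries one expects
  \<open>k\<close> positive answers, but each positive answer moves a vertex out of \<open>T\<close>, so that there were at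
  most about \<open>k - x\<close> of them. As \<open>x\<close> exceeds \<open>sqrt k\<close> by a factor tending to infinity, this
  large deviation has probability tending to 0. The Chernoff bound for the adaptively chosen queries
  is obtained by following an exponential potential through the search.\<close>

section \<open>Exposing the random edges one at a time\<close>

lemma measure_bind_bernoulli_pmf:
  assumes "0 \<le> p" "p \<le> 1"
  shows "measure_pmf.prob (bind_pmf (bernoulli_pmf p) f) A =
    p * measure_pmf.prob (f True) A + (1 - p) * measure_pmf.prob (f False) A"
proof -
  have "measure_pmf.prob (bind_pmf (bernoulli_pmf p) f) A =
      (\<integral>b. measure_pmf.prob (f b) A \<partial>measure_pmf (bernoulli_pmf p))"
    unfolding measure_pmf_bind
    by (rule measure_pmf.measure_bind[where N = "count_space UNIV"]) (auto simp: measure_subprob)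
  then show ?thesis
    using assms by (simp add: algebra_simps)
qed

text \<open>The search has found the edges in \<open>D\<close> and may still query those in
  \<open>R\<close>; all others count as absent. As \<open>L\<close> bounds the number of vertices, a
  path exceeding it has at least \<open>L\<close> edges.\<close>

definition prob_short_paths :: "'a set \<Rightarrow> real \<Rightarrow> nat \<Rightarrow> 'a set set \<Rightarrow> 'a set set \<Rightarrow> real" where
  "prob_short_paths V p L D R = measure_pmf.prob (Pi_pmf R False (\<lambda>_. bernoulli_pmf p))
     {keep. \<forall>vs. is_path \<lparr>vertices = V, edges = D \<union> {e \<in> R. keep e}\<rparr> vs \<longrightarrow> length vs \<le> L}"

text \<open>Condition on the answer for \<open>e\<close>: a positive one puts it into
  \<open>D\<close>, a negative one discards it. Adaptive querying is modelled by this recursion,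
  with \<open>e\<close> chosen in terms of the current state of the search.\<close>

lemma prob_short_paths_insert:
  assumes "finite R" "e \<notin> R" "0 \<le> p" "p \<le> 1"
  shows "prob_short_paths V p L D (insert e R) =
    p * prob_short_paths V p L (insert e D) R + (1 - p) * prob_short_paths V p L D R"
proof -
  have eq: "D \<union> {e' \<in> insert e R. (f(e := b)) e'} =
      (if b then insert e D else D) \<union> {e' \<in> R. f e'}" for f b
    using assms(2) by auto
  show ?thesis
    unfolding prob_short_paths_def Pi_pmf_insert'[OF assms(1,2)]
      measure_bind_bernoulli_pmf[OF assms(3,4)]
    by (simp only: map_pmf_def[symmetric] measure_map_pmf vimage_Collect_eq eq if_True if_False)
qed

lemma is_path_mono:
  assumes "is_path \<lparr>vertices = V, edges = D\<rparr> vs" "D \<subseteq> D'"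
  shows "is_path \<lparr>vertices = V, edges = D'\<rparr> vs"
  using assms by (auto simp: is_path_def)

lemma is_path_Cons_Cons:
  assumes "is_path \<lparr>vertices = V, edges = D\<rparr> (u # us)" "t \<in> V" "t \<notin> set (u # us)"
  shows "is_path \<lparr>vertices = V, edges = insert {u, t} D\<rparr> (t # u # us)"
  using assms by (auto simp: is_path_def nth_Cons insert_commute split: nat.splits)

lemma is_path_tl:
  assumes "is_path \<lparr>vertices = V, edges = D\<rparr> (u # us)" "us \<noteq> []"
  shows "is_path \<lparr>vertices = V, edges = D\<rparr> us"
  using assms by (fastforce simp: is_path_def)

lemma prob_short_paths_eq_0:
  assumes "is_path \<lparr>vertices = V, edges = D\<rparr> vs" "L < length vs"
  shows "prob_short_paths V p L D R = 0"
proof -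
  have "is_path \<lparr>vertices = V, edges = D \<union> {e \<in> R. keep e}\<rparr> vs" for keep
    using is_path_mono[OF assms(1)] by simp
  then have "{keep. \<forall>vs. is_path \<lparr>vertices = V, edges = D \<union> {e \<in> R. keep e}\<rparr> vs \<longrightarrow> length vs \<le> L} = {}"
    using assms(2) by (auto simp: not_le)
  then show ?thesis
    by (simp only: prob_short_paths_def measure_empty)
qed

section \<open>Crossing edges and the depth-first search\<close>

text \<open>Of the at least \<open>k\<close> edges at a vertex of \<open>S\<close>, at most
  \<open>card S - 1\<close> stay in \<open>S\<close> and at most \<open>card U\<close> lead to
  \<open>U\<close>. The others are counted only once, because their second end lies outside
  \<open>S\<close>.\<close>

lemma card_crossing_edges_ge:
  fixes E :: "'a set set"
  assumes V: "finite V" and E: "\<And>e. e \<in> E \<Longrightarrow> e \<subseteq> V \<and> card e = 2"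
    and deg: "\<And>v. v \<in> V \<Longrightarrow> k \<le> card {e \<in> E. v \<in> e}"
    and "S \<subseteq> V" "finite U"
  shows "card S * (k - (card S - 1) - card U) \<le> card {{v, t} | v t. v \<in> S \<and> t \<in> V - S - U \<and> {v, t} \<in> E}"
proof -
  have finE: "finite E"
    using E V by (intro finite_subset[of E "Pow V"]) auto
  have finS: "finite S"
    using assms finite_subset by blast
  define X where "X v = (\<lambda>t. {v, t}) ` {t \<in> V - S - U. {v, t} \<in> E}" for v
  have "k - (card S - 1) - card U \<le> card (X v)" if v: "v \<in> S" for v
  proof -
    have "{e \<in> E. v \<in> e} \<subseteq> X v \<union> (\<lambda>t. {v, t}) ` (S - {v}) \<union> (\<lambda>t. {v, t}) ` U"
    proof
      fix e assume e: "e \<in> {e \<in> E. v \<in> e}"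
      then obtain a b where ab: "e = {a, b}" "a \<noteq> b"
        using E[of e] by (auto simp: card_2_iff)
      then obtain t where t: "e = {v, t}" "t \<noteq> v"
        using e by auto
      then have "t \<in> V"
        using E[of e] e by auto
      then show "e \<in> X v \<union> (\<lambda>t. {v, t}) ` (S - {v}) \<union> (\<lambda>t. {v, t}) ` U"
        using t e by (auto simp: X_def)
    qed
    then have "card {e \<in> E. v \<in> e} \<le> card (X v \<union> (\<lambda>t. {v, t}) ` (S - {v}) \<union> (\<lambda>t. {v, t}) ` U)"
      using finS V \<open>finite U\<close> by (intro card_mono) (auto simp: X_def)
    also have "\<dots> \<le> card (X v) + card ((\<lambda>t. {v, t}) ` (S - {v})) + card ((\<lambda>t. {v, t}) ` U)"
      by (meson add_le_mono card_Un_le le_refl order_trans)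
    also have "\<dots> \<le> card (X v) + card (S - {v}) + card U"
      using finS \<open>finite U\<close> by (intro add_mono card_image_le) auto
    finally show ?thesis
      using deg[of v] v finS \<open>S \<subseteq> V\<close> by (auto simp: card_Diff_singleton)
  qed
  then have "card S * (k - (card S - 1) - card U) \<le> (\<Sum>v\<in>S. card (X v))"
    using sum_bounded_below[of S _ "\<lambda>v. card (X v)"] by simp
  also have "\<dots> = card (\<Union>v\<in>S. X v)"
  proof (rule card_UN_disjoint[symmetric])
    show "\<forall>v\<in>S. finite (X v)"
      using V by (auto simp: X_def)
    show "\<forall>v\<in>S. \<forall>w\<in>S. v \<noteq> w \<longrightarrow> X v \<inter> X w = {}"
      by (auto simp: X_def doubleton_eq_iff)
  qed (fact finS)
  also have "(\<Union>v\<in>S. X v) = {{v, t} | v t. v \<in> S \<and> t \<in> V - S - U \<and> {v, t} \<in> E}"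
    by (auto simp: X_def)
  finally show ?thesis .
qed

text \<open>The parameters \<open>a\<close> and \<open>B\<close> make the right-hand side a martingale along the queries; starting
  the search in a new component can only decrease it. The set \<open>D\<close> contains the edges found so far,
  \<open>R\<close> those not yet queried.\<close>

lemma prob_short_paths_dfs:
  fixes V :: "'a set" and E :: "'a set set" and a B p :: real
  assumes V: "finite V" and E: "\<And>e. e \<in> E \<Longrightarrow> e \<subseteq> V \<and> card e = 2"
    and deg: "\<And>v. v \<in> V \<Longrightarrow> k \<le> card {e \<in> E. v \<in> e}"
    and s: "s < card V"
    and p: "0 \<le> p" "p \<le> 1" and a: "0 < a" "a \<le> 1" and B: "1 \<le> B" "B * (1 - p + p * a) = 1"
    and "S \<subseteq> V" "set U \<subseteq> V" "S \<inter> set U = {}" "card S \<le> s"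
    and "U \<noteq> [] \<Longrightarrow> is_path \<lparr>vertices = V, edges = D\<rparr> U"
    and "R \<subseteq> E" "\<And>v t. v \<in> S \<Longrightarrow> t \<in> V - S - set U \<Longrightarrow> {v, t} \<notin> R"
  shows "prob_short_paths V p L D R * (a ^ (s + L) * B ^ (s * (k - (s - 1) - L)))
    \<le> a ^ (card S + length U) * B ^ (card E - card R)"
  using assms(11-17)
\<comment> \<open>The weight 2 lets every move decrease the measure: pushing a vertex takes one from
  the untouched set but lengthens the stack by one. Popping shortens the stack, and a negative
  answer shrinks \<open>R\<close>.\<close>
proof (induction "2 * card (V - S - set U) + length U + card R" arbitrary: S U D R rule: less_induct)
  case less
  note prems = less.prems
  let ?c = "a ^ (s + L) * B ^ (s * (k - (s - 1) - L))"
  let ?T = "V - S - set U"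
  have finE: "finite E"
    using E V by (intro finite_subset[of E "Pow V"]) auto
  have finR: "finite R" and finS: "finite S" and finT: "finite ?T"
    using finE V prems finite_subset by blast+
  have pos: "0 \<le> ?c"
    using a B by simp
  consider (long) "L < length U" | (finished) "length U \<le> L" "card S = s"
    | (root) "length U \<le> L" "card S < s" "U = []"
    | (step) "card S < s" "U \<noteq> []"
    using prems by fastforce
  then show ?case
  proof cases
    case long
    then have "U \<noteq> []"
      by auto
    with long prems(5) prob_short_paths_eq_0[of V D U L p R] a B show ?thesis
      by simp
  next
    \<comment> \<open>The search stops here. All crossing edges have left \<open>R\<close>, which
      forces at least \<open>s * (k - (s - 1) - L)\<close> queries, and
      \<open>card S + length U\<close> is at most \<open>s + L\<close>. Since
      \<open>a \<le> 1 \<le> B\<close>, the right-hand side is at least \<open>?c\<close>.\<close>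
    case finished
    have "distinct U"
      using prems(5) by (cases "U = []") (auto simp: is_path_def)
    then have cU: "card (set U) = length U"
      by (rule distinct_card)
    have "s * (k - (s - 1) - L) \<le> card S * (k - (card S - 1) - card (set U))"
      using finished by (auto simp: cU)
    also have "\<dots> \<le> card {{v, t} | v t. v \<in> S \<and> t \<in> ?T \<and> {v, t} \<in> E}"
      using card_crossing_edges_ge[OF V E deg] prems by blast
    also have "\<dots> \<le> card (E - R)"
      using prems(7) finE by (intro card_mono) auto
    also have "\<dots> = card E - card R"
      using finR prems by (intro card_Diff_subset) auto
    finally have "B ^ (s * (k - (s - 1) - L)) \<le> B ^ (card E - card R)"
      using B by (intro power_increasing) auto
    moreover have "a ^ (s + L) \<le> a ^ (card S + length U)"
      using a finished by (intro power_decreasing) auto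
    ultimately have "?c \<le> a ^ (card S + length U) * B ^ (card E - card R)"
      using a B by (intro mult_mono) auto
    moreover have "prob_short_paths V p L D R * ?c \<le> ?c"
      using pos by (intro mult_left_le_one_le) (auto simp: prob_short_paths_def)
    ultimately show ?thesis
      by linarith
  next
    case root
    have "S \<noteq> V"
      using root s by auto
    then obtain v where v: "v \<in> V" "v \<notin> S"
      using prems(1) by blast
    have "V - S - set [v] = ?T - {v}" "v \<in> ?T"
      using v root by auto
    then have T: "card (V - S - set [v]) < card ?T"
      using finT by (metis card_Diff1_less)
    have "prob_short_paths V p L D R * ?c \<le> a ^ (card S + length [v]) * B ^ (card E - card R)"
    proof (rule less.hyps)
      show "2 * card (V - S - set [v]) + length [v] + card R < 2 * card ?T + length U + card R"
        using T root by simp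
    qed (use v prems root in \<open>auto simp: is_path_def\<close>)
    also have "\<dots> \<le> a ^ (card S + length U) * B ^ (card E - card R)"
      using a B root by (intro mult_right_mono power_decreasing) auto
    finally show ?thesis .
  next
    case step
    then obtain u us where U: "U = u # us"
      by (cases U) auto
    have path: "is_path \<lparr>vertices = V, edges = D\<rparr> (u # us)"
      using prems(5) U by simp
    show ?thesis
    \<comment> \<open>The head of the list is the top of the stack, the only vertex from which edges
      are queried.\<close>
    proof (cases "\<exists>t \<in> ?T. {u, t} \<in> R")
      case True
      then obtain t where t: "t \<in> ?T" "{u, t} \<in> R"
        by blast
      define R' where "R' = R - {{u, t}}"
      have R': "R = insert {u, t} R'" "{u, t} \<notin> R'" "finite R'" "card R = Suc (card R')"
        using t finR by (auto simp: R'_def card_Suc_Diff1 simp del: card_Diff_insert card_Diff_singleton)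
      have le: "Suc (card R') \<le> card E"
        using R' prems finE card_mono by metis
      have "V - S - set (t # U) = ?T - {t}"
        by auto
      then have T: "card (V - S - set (t # U)) < card ?T"
        using finT t by (metis card_Diff1_less)
      have pos_le: "prob_short_paths V p L (insert {u, t} D) R' * ?c
          \<le> a ^ (card S + length (t # U)) * B ^ (card E - card R')"
      proof (rule less.hyps)
        show "2 * card (V - S - set (t # U)) + length (t # U) + card R' < 2 * card ?T + length U + card R"
          using T R' by simp
        show "is_path \<lparr>vertices = V, edges = insert {u, t} D\<rparr> (t # U)"
          using is_path_Cons_Cons[OF path] t U by auto
      qed (use t prems R' in auto)
      have neg_le: "prob_short_paths V p L D R' * ?c \<le> a ^ (card S + length U) * B ^ (card E - card R')"
      proof (rule less.hyps)
        show "2 * card ?T + length U + card R' < 2 * card ?T + length U + card R"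
          using R' by simp
      qed (use prems R' in auto)
      have "card E - card R' = Suc (card E - card R)"
        using le R' by simp
      then have BR: "B ^ (card E - card R') = B * B ^ (card E - card R)"
        by simp
      have "prob_short_paths V p L D R * ?c =
          p * (prob_short_paths V p L (insert {u, t} D) R' * ?c) + (1 - p) * (prob_short_paths V p L D R' * ?c)"
        unfolding R'(1) prob_short_paths_insert[OF R'(3,2) p] by (simp add: algebra_simps)
      also have "\<dots> \<le> p * (a ^ (card S + length (t # U)) * B ^ (card E - card R'))
          + (1 - p) * (a ^ (card S + length U) * B ^ (card E - card R'))"
        using p by (intro add_mono mult_left_mono pos_le neg_le) auto
      \<comment> \<open>Every query costs a factor \<open>B\<close> and a positive answer a further
        factor \<open>a\<close>; the relation between \<open>B\<close> and \<open>a\<close>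
        preserves the average.\<close>
      also have "\<dots> = (B * (1 - p + p * a)) * (a ^ (card S + length U) * B ^ (card E - card R))"
        unfolding BR by (simp add: algebra_simps)
      finally show ?thesis
        using B by simp
    next
      \<comment> \<open>No query is left at \<open>u\<close>, so it moves from the stack to
        \<open>S\<close>. This changes neither the untouched set nor the exponent of
        \<open>a\<close>.\<close>
      case False
      have u: "u \<in> V" "u \<notin> S" "u \<notin> set us"
        using prems U path by (auto simp: is_path_def)
      have T: "V - insert u S - set us = ?T"
        using U by auto
      have cS: "card (insert u S) = Suc (card S)"
        using u finS by simp
      have "prob_short_paths V p L D R * ?c \<le> a ^ (card (insert u S) + length us) * B ^ (card E - card R)"
      proof (rule less.hyps)
        show "2 * card (V - insert u S - set us) + length us + card R < 2 * card ?T + length U + card R"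
          unfolding T by (simp add: U)
        show "{v, t} \<notin> R" if "v \<in> insert u S" "t \<in> V - insert u S - set us" for v t
          using that prems(7) False unfolding T by auto
        show "is_path \<lparr>vertices = V, edges = D\<rparr> us" if "us \<noteq> []"
          using is_path_tl[OF path that] .
      qed (use prems u U step cS in auto)
      then show ?thesis
        by (simp add: cS U)
    qed
  qed
qed

section \<open>The Chernoff bound\<close>

text \<open>Combine (1 - x + x^2) (1 + x) = 1 + x^3 with 1 + x \<le> exp x.\<close>

lemma exp_minus_le_quadratic:
  fixes x :: real
  assumes "0 \<le> x"
  shows "exp (- x) \<le> 1 - x + x\<^sup>2"
proof -
  have "1 \<le> (1 - x + x\<^sup>2) * (1 + x)"
    using assms by (simp add: algebra_simps power2_eq_square power3_eq_cube)
  also have "\<dots> \<le> (1 - x + x\<^sup>2) * exp x"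
  proof (rule mult_left_mono)
    have "1 - x + x\<^sup>2 = (1 - x / 2)\<^sup>2 + 3 / 4 * x\<^sup>2"
      by (simp add: power2_eq_square algebra_simps)
    then show "0 \<le> 1 - x + x\<^sup>2"
      by simp
  qed (use exp_ge_add_one_self[of x] in simp)
  finally show ?thesis
    by (simp add: exp_minus field_simps)
qed

text \<open>Start the search with nothing explored, where the potential is 1, and take
  \<open>a = exp (- \<theta>)\<close>. Then \<open>\<phi>\<close> is the Laplace transform of a
  single answer, and \<open>B\<close> is its inverse. The parameter \<open>\<theta>\<close> remains
  free to be optimised.\<close>

lemma prob_short_paths_le:
  fixes V :: "'a set" and E :: "'a set set" and p \<theta> :: real
  assumes V: "finite V" and E: "\<And>e. e \<in> E \<Longrightarrow> e \<subseteq> V \<and> card e = 2"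
    and deg: "\<And>v. v \<in> V \<Longrightarrow> k \<le> card {e \<in> E. v \<in> e}"
    and s: "s < card V" and p: "0 \<le> p" "p \<le> 1" and \<theta>: "0 \<le> \<theta>"
  shows "prob_short_paths V p L {} E
    \<le> exp (\<theta> * real (s + L) - p * real (s * (k - (s - 1) - L)) * (\<theta> - \<theta>\<^sup>2))"
proof -
  define a where "a = exp (- \<theta>)"
  define \<phi> where "\<phi> = 1 - p + p * a"
  let ?N = "s * (k - (s - 1) - L)"
  have a: "0 < a" "a \<le> 1"
    using \<theta> by (auto simp: a_def)
  have "p * a \<le> p"
    using a p by (simp add: mult_left_le)
  then have \<phi>1: "\<phi> \<le> 1"
    by (simp add: \<phi>_def)
  have \<phi>0: "0 < \<phi>"
  proof (cases "p = 0")
    case False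
    then have "0 < p * a"
      using a p by simp
    then show ?thesis
      using p by (simp add: \<phi>_def)
  qed (simp add: \<phi>_def)
  have "prob_short_paths V p L {} E * (a ^ (s + L) * (1 / \<phi>) ^ ?N)
      \<le> a ^ (card ({} :: 'a set) + length ([] :: 'a list)) * (1 / \<phi>) ^ (card E - card E)"
    using a \<phi>0 \<phi>1
    by (intro prob_short_paths_dfs[OF V E deg s p]) (auto simp: \<phi>_def[symmetric])
  then have "prob_short_paths V p L {} E * (a ^ (s + L) * (1 / \<phi>) ^ ?N) \<le> 1"
    by simp
  then have "prob_short_paths V p L {} E \<le> \<phi> ^ ?N / a ^ (s + L)"
    using a \<phi>0 by (simp add: field_simps)
  also have "\<dots> = \<phi> ^ ?N * exp (\<theta> * real (s + L))"
    by (simp add: a_def exp_of_nat_mult[symmetric] exp_minus field_simps)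
  also have "\<dots> \<le> exp (- p * (\<theta> - \<theta>\<^sup>2)) ^ ?N * exp (\<theta> * real (s + L))"
  proof (intro mult_right_mono power_mono)
    have "p * a \<le> p * (1 - \<theta> + \<theta>\<^sup>2)"
      using exp_minus_le_quadratic[OF \<theta>] p by (intro mult_left_mono) (auto simp: a_def)
    then have "\<phi> \<le> 1 + (- p * (\<theta> - \<theta>\<^sup>2))"
      by (simp add: \<phi>_def algebra_simps)
    also have "\<dots> \<le> exp (- p * (\<theta> - \<theta>\<^sup>2))"
      by (rule exp_ge_add_one_self)
    finally show "\<phi> \<le> exp (- p * (\<theta> - \<theta>\<^sup>2))" .
  qed (use \<phi>0 in auto)
  also have "\<dots> = exp (\<theta> * real (s + L) - p * real ?N * (\<theta> - \<theta>\<^sup>2))"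
    by (simp only: exp_of_nat_mult[symmetric] exp_add[symmetric]) (simp add: algebra_simps)
  finally show ?thesis .
qed

section \<open>Choice of parameters and the explicit error bound\<close>

text \<open>The hypotheses give k / sqrt c \<ge> 10, which is enough room to absorb all rounding
  errors.\<close>

lemma prob_long_path_ge:
  fixes G :: "'a ugraph" and c :: real
  assumes G: "finite_graph G" "k \<le> min_degree G" and c: "0 < c" "100 * c \<le> real k" and k: "1 \<le> k"
  shows "measure_pmf.prob (random_subgraph G (c / real k))
      {H. \<exists>vs. is_path H vs \<and> real (path_length vs) \<ge> (1 - 2 * c powr (-1/2)) * real k}
    \<ge> 1 - exp (- (real k / c) / 16)" (is "measure_pmf.prob _ ?good \<ge> _")
proof -
  define V E where "V = vertices G" and "E = edges G"
  have V: "finite V" "V \<noteq> {}" and E: "\<And>e. e \<in> E \<Longrightarrow> e \<subseteq> V \<and> card e = 2"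
    using G by (auto simp: finite_graph_def V_def E_def)
  have finE: "finite E"
    using E V by (intro finite_subset[of E "Pow V"]) auto
  have deg: "k \<le> card {e \<in> E. v \<in> e}" if "v \<in> V" for v
  proof -
    have "min_degree G \<le> degree G v"
      unfolding min_degree_def using that V by (intro Min_le) (auto simp: V_def)
    then show ?thesis
      using G by (simp add: degree_def E_def)
  qed
  have root: "c powr (-1/2) = 1 / sqrt c"
    using c by (simp add: powr_minus_divide powr_half_sqrt)
  define p where "p = c / real k"
  have p: "0 \<le> p" "p \<le> 1"
    using c k by (auto simp: p_def)
  show ?thesis
  \<comment> \<open>For c < 4 the required length is not positive and a single vertex suffices.
    Otherwise \<open>2 * x \<le> k\<close>, so the truncation at 0 in \<open>L\<close> is
    harmless.\<close>
  proof (cases "c < 4")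
    case True
    then have "sqrt c < 2"
      using real_sqrt_less_mono[of c 4] by simp
    then have "1 - 2 * c powr (-1/2) \<le> 0"
      unfolding root using c by (simp add: field_simps)
    then have le: "(1 - 2 * c powr (-1/2)) * real k \<le> 0"
      by (simp add: mult_nonpos_nonneg)
    obtain v where v: "v \<in> V"
      using V by blast
    have "H \<in> ?good" if "H \<in> set_pmf (random_subgraph G (c / real k))" for H
      using that v le
      by (auto simp: random_subgraph_def V_def is_path_def path_length_def intro!: exI[of _ "[v]"])
    then have "measure_pmf.prob (random_subgraph G (c / real k)) ?good = 1"
      by (subst measure_pmf.prob_eq_1) (auto simp: AE_measure_pmf_iff)
    then show ?thesis
      by simp
  next
    case False
    define x where "x = real k / sqrt c"
    define s where "s = nat \<lfloor>x\<rfloor>"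
    define L where "L = nat \<lceil>(1 - 2 * c powr (-1/2)) * real k\<rceil>"
    \<comment> \<open>This minimises \<open>real k * \<theta>\<^sup>2 - \<theta> * (x - 2)\<close>,
      the bound obtained below for the exponent.\<close>
    define \<theta> where "\<theta> = (x - 2) / (2 * real k)"
    let ?N = "s * (k - (s - 1) - L)"
    have sqrt_c: "2 \<le> sqrt c"
      using False real_sqrt_le_mono[of 4 c] by simp
    have x2: "2 * x \<le> real k"
      using mult_left_mono[OF sqrt_c, of "real k"] c by (simp add: x_def pos_divide_le_eq mult.commute)
    have xx: "x\<^sup>2 = real k * (real k / c)"
      using c by (simp add: x_def power_divide power2_eq_square)
    have kc: "100 \<le> real k / c"
      using c by (simp add: field_simps)
    have "1 * 100 \<le> real k * (real k / c)"
      using k kc by (intro mult_mono) auto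
    then have "10\<^sup>2 \<le> x\<^sup>2"
      by (simp add: xx)
    moreover have "0 \<le> x"
      using c by (simp add: x_def)
    ultimately have x10: "10 \<le> x"
      using power2_le_imp_le by blast
    have s_bounds: "real s \<le> x" "x < real s + 1"
      using x10 unfolding s_def by linarith+
    have target: "(1 - 2 * c powr (-1/2)) * real k = real k - 2 * x"
      unfolding root by (simp add: x_def algebra_simps)
    have L_bound: "real L < real k - 2 * x + 1"
      unfolding L_def target using x2 by linarith
    have "s < k"
      using s_bounds x2 x10 by linarith
    also have "k < card V"
    proof -
      obtain v where v: "v \<in> V"
        using V by blast
      have "{e \<in> E. v \<in> e} \<subseteq> (\<lambda>t. {v, t}) ` (V - {v})"
      proof
        fix e assume e: "e \<in> {e \<in> E. v \<in> e}"
        then obtain t where "e = {v, t}" "t \<noteq> v"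
          using E[of e] by (auto simp: card_2_iff insert_commute)
        then show "e \<in> (\<lambda>t. {v, t}) ` (V - {v})"
          using E[of e] e by auto
      qed
      then have "card {e \<in> E. v \<in> e} \<le> card (V - {v})"
        using V by (meson card_image_le card_mono finite_Diff finite_imageI order_trans)
      also have "\<dots> < card V"
        using v V by (simp add: card_gt_0_iff)
      finally show ?thesis
        using deg[OF v] by simp
    qed
    finally have s_card: "s < card V" .
    have \<theta>: "0 \<le> \<theta>" "\<theta> \<le> 1"
      using x10 x2 k by (auto simp: \<theta>_def field_simps)
    \<comment> \<open>As s (2 x - s) = x^2 - (x - s)^2, rounding \<open>x\<close> down to
      \<open>s\<close> costs at most 1.\<close>
    have "x\<^sup>2 - 1 \<le> real s * (2 * x - real s)"
    proof -
      have "(x - real s)\<^sup>2 \<le> 1"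
        using s_bounds by (intro power_le_one) auto
      then show ?thesis
        by (simp add: power2_eq_square algebra_simps)
    qed
    \<comment> \<open>Having \<open>s - 1\<close> instead of \<open>s\<close> compensates for the
      rounding up in \<open>L\<close>.\<close>
    also have "\<dots> \<le> real s * real (k - (s - 1) - L)"
      using L_bound s_bounds x10 by (intro mult_left_mono) linarith+
    finally have N: "x\<^sup>2 - 1 \<le> real ?N"
      by simp
    \<comment> \<open>Here p x^2 = k and p \<le> 1.\<close>
    have "real k - 1 \<le> p * (x\<^sup>2 - 1)"
      using p c k by (simp add: xx right_diff_distrib) (simp add: p_def field_simps)
    also have "\<dots> \<le> p * real ?N"
      using N p by (intro mult_left_mono) auto
    finally have pN: "real k - 1 \<le> p * real ?N" .
    have "\<theta>\<^sup>2 \<le> \<theta>"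
      using \<theta> by (simp add: power2_eq_square mult_left_le)
    have "\<theta> * real (s + L) - p * real ?N * (\<theta> - \<theta>\<^sup>2)
        \<le> \<theta> * (real k - x + 1) - (real k - 1) * (\<theta> - \<theta>\<^sup>2)"
    proof (intro diff_mono mult_left_mono mult_right_mono pN)
      show "real (s + L) \<le> real k - x + 1"
        using s_bounds L_bound by simp
    qed (use \<theta> \<open>\<theta>\<^sup>2 \<le> \<theta>\<close> in auto)
    also have "\<dots> \<le> real k * \<theta>\<^sup>2 - \<theta> * (x - 2)"
      by (simp add: algebra_simps)
    also have "\<dots> = - ((x - 2)\<^sup>2 / (4 * real k))"
      using k by (simp add: \<theta>_def power2_eq_square field_simps)
    \<comment> \<open>From x \<ge> 10 follows x - 2 \<ge> x / 2.\<close>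
    also have "\<dots> \<le> - ((x / 2)\<^sup>2 / (4 * real k))"
      using x10 by (intro le_imp_neg_le divide_right_mono power_mono) auto
    also have "\<dots> = - (real k / c) / 16"
      using k by (simp add: power_divide xx)
    finally have "\<theta> * real (s + L) - p * real ?N * (\<theta> - \<theta>\<^sup>2) \<le> - (real k / c) / 16" .
    then have bad: "prob_short_paths V p L {} E \<le> exp (- (real k / c) / 16)"
      using prob_short_paths_le[OF V(1) E deg s_card p \<theta>(1)]
      by (meson exp_le_cancel_iff order_trans)
    have "H \<in> ?good" if long: "\<not> (\<forall>vs. is_path H vs \<longrightarrow> length vs \<le> L)" for H :: "'a ugraph"
    proof -
      obtain vs where vs: "is_path H vs" "L < length vs"
        using long by (auto simp: not_le)
      then have "(1 - 2 * c powr (-1/2)) * real k \<le> real (path_length vs)"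
        unfolding path_length_def L_def by linarith
      with vs show ?thesis
        by blast
    qed
    then have "- {H. \<forall>vs. is_path H vs \<longrightarrow> length vs \<le> L} \<subseteq> ?good"
      by blast
    then have "measure_pmf.prob (random_subgraph G p) (- {H. \<forall>vs. is_path H vs \<longrightarrow> length vs \<le> L})
        \<le> measure_pmf.prob (random_subgraph G p) ?good"
      by (intro measure_pmf.finite_measure_mono) auto
    moreover have "measure_pmf.prob (random_subgraph G p) {H. \<forall>vs. is_path H vs \<longrightarrow> length vs \<le> L}
        = prob_short_paths V p L {} E"
      by (simp add: random_subgraph_def prob_short_paths_def V_def E_def vimage_def)
    ultimately show ?thesis
      using bad measure_pmf.prob_compl[of "{H. \<forall>vs. is_path H vs \<longrightarrow> length vs \<le> L}" "random_subgraph G p"]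
      by (simp add: p_def Compl_eq_Diff_UNIV)
  qed
qed

section \<open>Passage to the limit\<close>

theorem theorem1p1:
  fixes G :: "nat \<Rightarrow> 'a ugraph" and c p :: "nat \<Rightarrow> real"
  assumes "\<And>k. c k > 0"
    and "c \<in> o(\<lambda>k. real k)"
    and "\<And>k. p k = c k / real k"
    and "\<And>k. finite_graph (G k)"
    and "\<And>k. min_degree (G k) \<ge> k"
  shows "asymptotically_almost_surely (\<lambda>k. random_subgraph (G k) (p k))
    (\<lambda>k H. \<exists>vs. is_path H vs \<and>
       real (path_length vs) \<ge> (1 - 2 * c k powr (-1/2)) * real k)"
  unfolding asymptotically_almost_surely_def
proof (rule tendsto_sandwich)
  \<comment> \<open>The growth condition on \<open>c\<close> enters twice: with 1/100 it makes the
    explicit bound available for large \<open>k\<close>, and with arbitrary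
    \<open>\<epsilon>\<close> it sends k / c to infinity, so that the error vanishes.\<close>
  have small: "eventually (\<lambda>k. c k \<le> \<epsilon> * real k) sequentially" if "\<epsilon> > 0" for \<epsilon>
    using landau_o.smallD[OF assms(2) that] assms(1) by (simp add: less_imp_le)
  show "eventually (\<lambda>k. 1 - exp (- (real k / c k) / 16) \<le>
      measure_pmf.prob (random_subgraph (G k) (p k))
        {H. \<exists>vs. is_path H vs \<and> real (path_length vs) \<ge> (1 - 2 * c k powr (-1/2)) * real k}) sequentially"
    using small[of "1 / 100", simplified] eventually_ge_at_top[of 1]
  proof eventually_elim
    case (elim k)
    then show ?case
      unfolding assms(3) using assms(1,4,5) by (intro prob_long_path_ge) auto
  qed
  have "filterlim (\<lambda>k. real k / c k) at_top sequentially"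
    unfolding filterlim_at_top_gt[where c = 0]
  proof (intro allI impI)
    fix Z :: real assume "Z > 0"
    then show "eventually (\<lambda>k. Z \<le> real k / c k) sequentially"
      using small[of "1 / Z"] assms(1) by (auto elim!: eventually_mono simp: field_simps)
  qed
  then have "filterlim (\<lambda>k. (1 / 16) * (real k / c k)) at_top sequentially"
    by (rule filterlim_tendsto_pos_mult_at_top[OF tendsto_const, rotated]) simp
  then have "filterlim (\<lambda>k. - ((1 / 16) * (real k / c k))) at_bot sequentially"
    by (rule filterlim_compose[OF filterlim_uminus_at_bot_at_top])
  then have "(\<lambda>k. exp (- ((1 / 16) * (real k / c k)))) \<longlonglongrightarrow> 0"
    by (rule filterlim_compose[OF exp_at_bot])
  then have "(\<lambda>k. 1 - exp (- (real k / c k) / 16)) \<longlonglongrightarrow> 1 - 0"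
    by (intro tendsto_diff tendsto_const) (simp add: mult.commute)
  then show "(\<lambda>k. 1 - exp (- (real k / c k) / 16)) \<longlonglongrightarrow> 1"
    by simp
  show "eventually (\<lambda>k. measure_pmf.prob (random_subgraph (G k) (p k))
      {H. \<exists>vs. is_path H vs \<and> real (path_length vs) \<ge> (1 - 2 * c k powr (-1/2)) * real k} \<le> 1) sequentially"
    by simp
qed simp

end
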